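(* Let $k<n<N$ be nonnegative integers and let $H^N=[0,1]^N$ be the hypercube. Call a vector in $H^N$ $k$-simple if all of its entries except at most $k$ are at the bounds $0$ or $1$. Let $x_0\in H^N$ be a $k$-simple vector, let $A$ be an $n\times N$ random matrix with an orthant-symmetric and generic random nullspace, and let $b=Ax_0$. Then, with probability $1-P_{N-n,N-k}$, the inequality-constrained system $Ax=b$, $x\in H^N$ has $x_0$ as its unique solution in the hypercube. Here, for positive integers $m,M$, $$P_{m,M}=2^{-M+1}\sum_{\ell=0}^{m-1}\binom{M-1}{\ell}.$$
   Context: A random $(N-n)\times N$ matrix $B$ is orthant-symmetric if for each diagonal matrix $S$ with diagonal in $\{-1,1\}^N$ and every measurable set $\Omega$, $\mathrm{Prob}\{BS\in\Omega\}=\mathrm{Prob}\{B\in\Omega\}$. Let $V_B$ be the linear span of the rows of $B$. If $B$ is orthant-symmetric, $V_B$ is called an orthant-symmetric random subspace. If every subset of $N-n$ columns of $B$ is almost surely linearly independent, $V_B$ is called a generic random subspace. A random $n\times N$ matrix $A$ has an orthant-symmetric and generic random nullspace if its nullspace equals $V_B$ for a random matrix $B$ having both properties. $P_{m,M}$ is the probability of at most $m-1$ heads in $M-1$ tosses of a fair coin.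
   Formalization: The probability equals 1-P_{N-n,N-k} only when exactly k entries of x_0 are off the bounds; for k-simple x_0 with fewer such entries it is strictly larger, so for general k-simple x_0 only "at least 1-P_{N-n,N-k}" is claimed. *)

theory Defs
  imports "HOL-Probability.Probability"
begin

definition hypercube :: "(real ^ 'N::finite) set"
  where "hypercube = {x. \<forall>i. x $ i \<in> {0..1}}"

definition free_entries :: "real ^ 'N::finite \<Rightarrow> 'N set"
  where "free_entries x = {i. x $ i \<noteq> 0 \<and> x $ i \<noteq> 1}"

(* "At most k": if only j < k entries are free, the probability of unique recovery is
   1 - P_{N-n,N-j}, which exceeds 1 - P_{N-n,N-k}. Hence equality with the latter can be
   claimed only for exactly k free entries, and a lower bound in general. *)
definition k_simple :: "nat \<Rightarrow> real ^ 'N::finite \<Rightarrow> bool"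
  where "k_simple k x \<longleftrightarrow> x \<in> hypercube \<and> card (free_entries x) \<le> k"

definition sign_diagonal :: "real ^ 'N ^ 'N::finite \<Rightarrow> bool"
  where "sign_diagonal S \<longleftrightarrow>
    (\<forall>i j. i \<noteq> j \<longrightarrow> S $ i $ j = 0) \<and> (\<forall>i. S $ i $ i \<in> {-1, 1})"

definition orthant_symmetric :: "'w measure \<Rightarrow> ('w \<Rightarrow> real ^ 'N::finite ^ 'm::finite) \<Rightarrow> bool"
  where "orthant_symmetric M B \<longleftrightarrow>
    (\<forall>S. sign_diagonal S \<longrightarrow>
      (\<forall>\<Omega> \<in> sets borel.
        measure M {\<omega> \<in> space M. B \<omega> ** S \<in> \<Omega>} = measure M {\<omega> \<in> space M. B \<omega> \<in> \<Omega>}))"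

(* Independence is that of the family of columns indexed by J: the constant independent
   only speaks about the set of columns, so repeated columns must be excluded by inj_on. *)
definition generic_matrix :: "'w measure \<Rightarrow> ('w \<Rightarrow> real ^ 'N::finite ^ 'm::finite) \<Rightarrow> bool"
  where "generic_matrix M B \<longleftrightarrow>
    (\<forall>J :: 'N set. card J = CARD('m) \<longrightarrow>
      (AE \<omega> in M. inj_on (\<lambda>j. column j (B \<omega>)) J \<and>
                  independent ((\<lambda>j. column j (B \<omega>)) ` J)))"

definition nullspace :: "real ^ 'N::finite ^ 'n::finite \<Rightarrow> (real ^ 'N) set"
  where "nullspace A = {x. A *v x = 0}"

(* The matrix B is (N - n) x N, and the two random subspaces agree almost surely. *)
definition nullspace_spanned_by ::
  "'w measure \<Rightarrow> ('w \<Rightarrow> real ^ 'N::finite ^ 'n::finite) \<Rightarrow> ('w \<Rightarrow> real ^ 'N ^ 'm::finite) \<Rightarrow> bool"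
  where "nullspace_spanned_by M A B \<longleftrightarrow>
    CARD('m) = CARD('N) - CARD('n) \<and> (AE \<omega> in M. nullspace (A \<omega>) = span (rows (B \<omega>)))"

(* Meant for positive m and M only. *)
definition head_prob :: "nat \<Rightarrow> nat \<Rightarrow> real"
  where "head_prob m M = 2 powi (- int M + 1) * (\<Sum>l = 0..m - 1. real ((M - 1) choose l))"

end

theory Submission imports Defs begin

text \<open>
  The vector \<open>x\<^sub>0\<close> fails to be the unique solution iff some nonzero null vector of \<open>A\<close> points into
  the cube, that is, iff a nonzero combination of the rows of \<open>B\<close> has prescribed weak signs on the
  set \<open>I\<close> of bound coordinates. Since the columns of \<open>B\<close> are in general position, the weak
  signs can be perturbed to strict ones, so the event says that one sign pattern on \<open>I\<close> is
  realized by the columns of \<open>B\<close>. Orthant symmetry makes all \<open>2 ^ card I\<close> patterns equally likely,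
  and almost surely the number of realized patterns is the number of regions of a central
  arrangement in general position (Schlaefli, Cover), obtained by adding one hyperplane at a time.
\<close>

section \<open>Counting sign patterns of vectors in general position\<close>

text \<open>A sign vector on \<open>I\<close> is encoded by its set \<open>P\<close> of positive
  positions. Signs are strict, so patterns correspond to the regions cut out of \<open>V\<close> by
  the hyperplanes orthogonal to the \<open>c i\<close>. The subspace \<open>V\<close> is a parameter
  because the count recurses into hyperplanes.\<close>

definition sign_patterns :: "'i set \<Rightarrow> ('i \<Rightarrow> 'a::real_inner) \<Rightarrow> 'a set \<Rightarrow> 'i set set"
  where "sign_patterns I c V =
    {P. P \<subseteq> I \<and> (\<exists>y\<in>V. (\<forall>i\<in>P. c i \<bullet> y > 0) \<and> (\<forall>i\<in>I - P. c i \<bullet> y < 0))}"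

text \<open>For a subspace \<open>V\<close> and finite \<open>I\<close>: any at most
  \<open>dim V\<close> of the functionals \<open>c j\<close> are independent on \<open>V\<close>.
  Stated through common zeros, the condition restricts to a subspace without projecting the
  \<open>c j\<close> into it.\<close>

definition general_position :: "'i set \<Rightarrow> ('i \<Rightarrow> 'a::euclidean_space) \<Rightarrow> 'a set \<Rightarrow> bool"
  where "general_position I c V \<longleftrightarrow>
    (\<forall>J\<subseteq>I. card J \<le> dim V \<longrightarrow> dim {y\<in>V. \<forall>j\<in>J. c j \<bullet> y = 0} + card J = dim V)"

text \<open>The number of regions of \<open>n\<close> central hyperplanes in general position in
  dimension \<open>d\<close>. The value 0 at \<open>d = 0\<close> reflects that the zero space
  realizes no strict sign.\<close>

fun schlaefli :: "nat \<Rightarrow> nat \<Rightarrow> nat" where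
  "schlaefli 0 d = 1"
| "schlaefli (Suc n) 0 = 0"
| "schlaefli (Suc n) (Suc d) = schlaefli n (Suc d) + schlaefli n d"

lemma sign_patterns_subset: "sign_patterns I c V \<subseteq> Pow I"
  by (auto simp: sign_patterns_def)

lemma finite_sign_patterns: "finite I \<Longrightarrow> finite (sign_patterns I c V)"
  by (rule finite_subset[OF sign_patterns_subset]) simp

text \<open>Finitely many strict inequalities persist under a small move in any direction
  \<open>z\<close>.\<close>

lemma sign_patterns_perturb:
  fixes c :: "'i \<Rightarrow> 'a::real_inner"
  assumes "finite I" "P \<subseteq> I" "\<forall>i\<in>P. c i \<bullet> y > 0" "\<forall>i\<in>I - P. c i \<bullet> y < 0"
  obtains t where "t > 0" "\<forall>i\<in>P. c i \<bullet> (y + t *\<^sub>R z) > 0" "\<forall>i\<in>I - P. c i \<bullet> (y + t *\<^sub>R z) < 0"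
proof -
  have lim: "((\<lambda>t. c i \<bullet> (y + t *\<^sub>R z)) \<longlongrightarrow> c i \<bullet> (y + 0 *\<^sub>R z)) (at_right 0)" for i
    by (intro tendsto_intros)
  have "eventually (\<lambda>t. \<forall>i\<in>P. c i \<bullet> (y + t *\<^sub>R z) > 0) (at_right 0)"
    using assms finite_subset lim by (intro eventually_ball_finite ballI order_tendstoD(1)[OF lim]) auto
  moreover have "eventually (\<lambda>t. \<forall>i\<in>I - P. c i \<bullet> (y + t *\<^sub>R z) < 0) (at_right 0)"
    using assms lim by (intro eventually_ball_finite ballI order_tendstoD(2)[OF lim]) auto
  ultimately have "eventually (\<lambda>t. t > 0 \<and> (\<forall>i\<in>P. c i \<bullet> (y + t *\<^sub>R z) > 0) \<and>
      (\<forall>i\<in>I - P. c i \<bullet> (y + t *\<^sub>R z) < 0)) (at_right (0::real))"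
    by (intro eventually_conj eventually_at_right_less)
  from eventually_happens[OF this] show ?thesis
    using that by auto
qed

text \<open>Deletion-restriction: a pattern on \<open>I\<close> extends to \<open>a\<close> with
  negative sign (\<open>A0\<close>), positive sign (\<open>A1\<close>), or both. Every pattern on
  \<open>I\<close> extends in some way, and it extends both ways iff it is realized on the
  hyperplane of \<open>a\<close>. Hence the count is
  \<open>card (A0 \<union> A1) + card (A0 \<inter> A1)\<close>.\<close>

lemma card_sign_patterns_insert:
  fixes c :: "'i \<Rightarrow> 'a::real_inner"
  assumes "finite I" "a \<notin> I" "subspace V" "z \<in> V" "c a \<bullet> z \<noteq> 0"
  shows "card (sign_patterns (insert a I) c V) =
    card (sign_patterns I c V) + card (sign_patterns I c {y\<in>V. c a \<bullet> y = 0})"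
proof -
  \<comment> \<open>Adding a multiple of \<open>w\<close> shifts the value of \<open>c a\<close> by
    that multiple, so \<open>w\<close> and \<open>- w\<close> leave the hyperplane on either
    side.\<close>
  define w where "w = (1 / (c a \<bullet> z)) *\<^sub>R z"
  have w: "w \<in> V" "- w \<in> V" "c a \<bullet> w = 1"
    using assms by (auto simp: w_def subspace_scale subspace_neg)
  define A0 where "A0 = {P. P \<subseteq> I \<and> (\<exists>y\<in>V. (\<forall>i\<in>P. c i \<bullet> y > 0) \<and> (\<forall>i\<in>I - P. c i \<bullet> y < 0) \<and> c a \<bullet> y < 0)}"
  define A1 where "A1 = {P. P \<subseteq> I \<and> (\<exists>y\<in>V. (\<forall>i\<in>P. c i \<bullet> y > 0) \<and> (\<forall>i\<in>I - P. c i \<bullet> y < 0) \<and> c a \<bullet> y > 0)}"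
  have fin: "finite A0" "finite A1"
    using assms(1) by (auto simp: A0_def A1_def intro: finite_subset[of _ "Pow I"])
  have split: "sign_patterns (insert a I) c V = A0 \<union> insert a ` A1"
  proof (intro equalityI subsetI)
    fix P assume "P \<in> sign_patterns (insert a I) c V"
    then obtain y where y: "P \<subseteq> insert a I" "y \<in> V" "\<forall>i\<in>P. c i \<bullet> y > 0" "\<forall>i\<in>insert a I - P. c i \<bullet> y < 0"
      by (auto simp: sign_patterns_def)
    show "P \<in> A0 \<union> insert a ` A1"
    proof (cases "a \<in> P")
      case True
      then have "P - {a} \<in> A1" using y assms(2) by (auto simp: A1_def intro!: bexI[of _ y])
      moreover have "P = insert a (P - {a})" using True by auto
      ultimately show ?thesis by blast
    next
      case False
      then have "P \<in> A0" using y by (auto simp: A0_def intro!: bexI[of _ y])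
      then show ?thesis by blast
    qed
  next
    fix P assume "P \<in> A0 \<union> insert a ` A1"
    then consider "P \<in> A0" | Q where "Q \<in> A1" "P = insert a Q" by blast
    then show "P \<in> sign_patterns (insert a I) c V"
    proof cases
      case 1
      then obtain y where "P \<subseteq> I" "y \<in> V" "\<forall>i\<in>P. c i \<bullet> y > 0" "\<forall>i\<in>I - P. c i \<bullet> y < 0" "c a \<bullet> y < 0"
        by (auto simp: A0_def)
      then show ?thesis by (auto simp: sign_patterns_def intro!: bexI[of _ y])
    next
      case 2
      then obtain y where "Q \<subseteq> I" "y \<in> V" "\<forall>i\<in>Q. c i \<bullet> y > 0" "\<forall>i\<in>I - Q. c i \<bullet> y < 0" "c a \<bullet> y > 0"
        by (auto simp: A1_def)
      then show ?thesis using 2 by (auto simp: sign_patterns_def intro!: bexI[of _ y])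
    qed
  qed
  have "card (sign_patterns (insert a I) c V) = card A0 + card (insert a ` A1)"
    unfolding split using fin assms(2) by (intro card_Un_disjoint) (auto simp: A0_def)
  also have "card (insert a ` A1) = card A1"
  proof (rule card_image)
    show "inj_on (insert a) A1"
      using assms(2) by (intro inj_onI) (auto simp: A1_def insert_ident subset_iff)
  qed
  also have "card A0 + card A1 = card (A0 \<union> A1) + card (A0 \<inter> A1)"
    using fin by (rule card_Un_Int)
  also have "A0 \<union> A1 = sign_patterns I c V"
  proof (intro equalityI subsetI)
    fix P assume "P \<in> A0 \<union> A1"
    then show "P \<in> sign_patterns I c V"
      by (auto simp: A0_def A1_def sign_patterns_def)
  next
    fix P assume "P \<in> sign_patterns I c V"
    then obtain y where y: "P \<subseteq> I" "y \<in> V" "\<forall>i\<in>P. c i \<bullet> y > 0" "\<forall>i\<in>I - P. c i \<bullet> y < 0"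
      by (auto simp: sign_patterns_def)
    obtain t where t: "t > 0" "\<forall>i\<in>P. c i \<bullet> (y + t *\<^sub>R w) > 0" "\<forall>i\<in>I - P. c i \<bullet> (y + t *\<^sub>R w) < 0"
      using sign_patterns_perturb[OF assms(1) y(1,3,4)] by blast
    have tV: "y + t *\<^sub>R w \<in> V" using y w assms(3) by (simp add: subspace_add subspace_scale)
    consider "c a \<bullet> y < 0" | "c a \<bullet> y > 0" | "c a \<bullet> y = 0" by linarith
    then show "P \<in> A0 \<union> A1"
    proof cases
      case 1 then have "P \<in> A0" using y unfolding A0_def by blast
      then show ?thesis by blast
    next
      case 2 then have "P \<in> A1" using y unfolding A1_def by blast
      then show ?thesis by blast
    next
      case 3
      then have "c a \<bullet> (y + t *\<^sub>R w) > 0" using t w by (simp add: inner_add_right)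
      then have "P \<in> A1" using t tV y(1) unfolding A1_def by blast
      then show ?thesis by blast
    qed
  qed
  also have "A0 \<inter> A1 = sign_patterns I c {y\<in>V. c a \<bullet> y = 0}"
  proof (intro equalityI subsetI)
    fix P assume "P \<in> A0 \<inter> A1"
    then obtain u v where u: "P \<subseteq> I" "u \<in> V" "\<forall>i\<in>P. c i \<bullet> u > 0" "\<forall>i\<in>I - P. c i \<bullet> u < 0" "c a \<bullet> u < 0"
      and v: "v \<in> V" "\<forall>i\<in>P. c i \<bullet> v > 0" "\<forall>i\<in>I - P. c i \<bullet> v < 0" "c a \<bullet> v > 0"
      by (auto simp: A0_def A1_def)
    \<comment> \<open>The segment from \<open>u\<close> to \<open>v\<close> crosses the hyperplane
      of \<open>a\<close>. Up to scaling \<open>y\<close> is the crossing point; both coefficients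
      are positive, so the common signs on \<open>I\<close> survive.\<close>
    define y where "y = (c a \<bullet> v) *\<^sub>R u + (- (c a \<bullet> u)) *\<^sub>R v"
    have "y \<in> V" using u v assms(3) by (simp add: y_def subspace_add subspace_diff subspace_scale)
    moreover have "c a \<bullet> y = 0" by (simp add: y_def inner_diff_right)
    moreover have "c i \<bullet> y > 0" if "i \<in> P" for i
      using u v that unfolding y_def inner_add_right inner_scaleR_right
      by (intro add_pos_pos mult_pos_pos) auto
    moreover have "c i \<bullet> y < 0" if "i \<in> I - P" for i
      using u v that unfolding y_def inner_add_right inner_scaleR_right
      by (intro add_neg_neg mult_pos_neg) auto
    ultimately show "P \<in> sign_patterns I c {y\<in>V. c a \<bullet> y = 0}"
      using u(1) unfolding sign_patterns_def by blast
  next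
    fix P assume "P \<in> sign_patterns I c {y\<in>V. c a \<bullet> y = 0}"
    then obtain y where y: "P \<subseteq> I" "\<forall>i\<in>P. c i \<bullet> y > 0" "\<forall>i\<in>I - P. c i \<bullet> y < 0" "y \<in> V" "c a \<bullet> y = 0"
      by (auto simp: sign_patterns_def)
    obtain t where t: "t > 0" "\<forall>i\<in>P. c i \<bullet> (y + t *\<^sub>R w) > 0" "\<forall>i\<in>I - P. c i \<bullet> (y + t *\<^sub>R w) < 0"
      using sign_patterns_perturb[OF assms(1) y(1,2,3)] by blast
    have "y + t *\<^sub>R w \<in> V" "c a \<bullet> (y + t *\<^sub>R w) > 0"
      using y w t assms(3) by (auto simp: subspace_add subspace_scale inner_add_right)
    then have "P \<in> A1" using t y(1) unfolding A1_def by blast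
    moreover obtain s where s: "s > 0" "\<forall>i\<in>P. c i \<bullet> (y + s *\<^sub>R (- w)) > 0"
        "\<forall>i\<in>I - P. c i \<bullet> (y + s *\<^sub>R (- w)) < 0"
      using sign_patterns_perturb[OF assms(1) y(1,2,3)] by blast
    have "y + s *\<^sub>R (- w) \<in> V" "c a \<bullet> (y + s *\<^sub>R (- w)) < 0"
      using y w s assms(3) by (auto simp: subspace_diff subspace_scale inner_diff_right)
    then have "P \<in> A0" using s y(1) unfolding A0_def by blast
    ultimately show "P \<in> A0 \<inter> A1" by blast
  qed
  finally show ?thesis .
qed

lemma general_position_subset:
  "general_position I c V \<Longrightarrow> J \<subseteq> I \<Longrightarrow> general_position J c V"
  by (auto simp: general_position_def)

text \<open>The condition for \<open>J\<close> inside the hyperplane is the condition for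
  \<open>insert a J\<close> in \<open>V\<close>, with one dimension and one functional moved
  across.\<close>

lemma general_position_hyperplane:
  assumes "finite I" "a \<notin> I" "general_position (insert a I) c V" "dim V = Suc d"
  shows "general_position I c {y\<in>V. c a \<bullet> y = 0}" "dim {y\<in>V. c a \<bullet> y = 0} = d"
proof -
  show d: "dim {y\<in>V. c a \<bullet> y = 0} = d"
    using assms(3)[unfolded general_position_def, rule_format, of "{a}"] assms(4) by simp
  show "general_position I c {y\<in>V. c a \<bullet> y = 0}"
    unfolding general_position_def
  proof (intro allI impI)
    fix J assume J: "J \<subseteq> I" "card J \<le> dim {y\<in>V. c a \<bullet> y = 0}"
    have "card (insert a J) = Suc (card J)"
      using J assms by (auto simp: finite_subset intro!: card_insert_disjoint)
    moreover have "{y\<in>{y\<in>V. c a \<bullet> y = 0}. \<forall>j\<in>J. c j \<bullet> y = 0} = {y\<in>V. \<forall>j\<in>insert a J. c j \<bullet> y = 0}"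
      by auto
    ultimately show "dim {y\<in>{y\<in>V. c a \<bullet> y = 0}. \<forall>j\<in>J. c j \<bullet> y = 0} + card J = dim {y\<in>V. c a \<bullet> y = 0}"
      using assms(3)[unfolded general_position_def, rule_format, of "insert a J"] J assms(4) d by auto
  qed
qed

theorem card_sign_patterns:
  fixes c :: "'i \<Rightarrow> 'a::euclidean_space"
  assumes "finite I" "subspace V" "general_position I c V"
  shows "card (sign_patterns I c V) = schlaefli (card I) (dim V)"
  using assms
proof (induction I arbitrary: V rule: finite_induct)
  case empty
  then have "sign_patterns {} c V = {{}}"
    by (auto simp: sign_patterns_def dest: subspace_0)
  then show ?case by simp
next
  case (insert a I)
  show ?case
  proof (cases "dim V")
    case 0
    then have "V = {0}" using insert.prems(1) subspace_0 by (auto simp: dim_eq_0)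
    then have "sign_patterns (insert a I) c V = {}" by (auto simp: sign_patterns_def)
    then show ?thesis using insert.hyps 0 by (simp del: dim_eq_0)
  next
    case (Suc d)
    let ?W = "{y\<in>V. c a \<bullet> y = 0}"
    note gp = general_position_hyperplane[OF insert.hyps insert.prems(2) Suc]
    have sub: "subspace ?W"
      using insert.prems(1) by (auto simp: subspace_def inner_add_right)
    \<comment> \<open>If \<open>c a\<close> vanished on \<open>V\<close>, the section would keep the
      full dimension of \<open>V\<close>.\<close>
    have "\<exists>z\<in>V. c a \<bullet> z \<noteq> 0"
    proof (rule ccontr)
      assume "\<not> ?thesis"
      then have "?W = V" by blast
      then show False using gp(2) Suc by simp
    qed
    then obtain z where "z \<in> V" "c a \<bullet> z \<noteq> 0" by blast
    from card_sign_patterns_insert[of I a V z c, OF insert.hyps insert.prems(1) this]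
    show ?thesis
      using insert.IH[OF insert.prems(1) general_position_subset[OF insert.prems(2)]]
        insert.IH[OF sub gp(1)] gp(2) Suc insert.hyps
      by auto
  qed
qed

section \<open>Schlaefli numbers in closed form and as coin-toss probabilities\<close>

lemma schlaefli_full: "n \<le> d \<Longrightarrow> schlaefli n d = 2 ^ n"
  by (induction n d rule: schlaefli.induct) auto

text \<open>By Pascal's rule the partial binomial sums obey the recursion defining
  \<open>schlaefli\<close>.\<close>

lemma schlaefli_Suc: "schlaefli (Suc n) d = 2 * (\<Sum>l<d. n choose l)"
proof (induction n arbitrary: d)
  case 0
  have "(\<Sum>l<Suc e. (0 choose l)) = 1" for e by (induction e) auto
  then show ?case by (cases d) auto
next
  case (Suc n)
  show ?case
  proof (cases d)
    case (Suc e)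
    have "(\<Sum>l<Suc e. Suc n choose l) = 1 + (\<Sum>l<e. (n choose l) + (n choose Suc l))"
      by (simp only: sum.lessThan_Suc_shift binomial_Suc_Suc) simp
    also have "\<dots> = (\<Sum>l<e. n choose l) + (\<Sum>l<Suc e. n choose l)"
      by (simp only: sum.lessThan_Suc_shift sum.distrib) simp
    finally show ?thesis
      using Suc.IH[of d] Suc.IH[of e] Suc by (simp del: sum.lessThan_Suc)
  qed simp
qed

lemma schlaefli_mono: "schlaefli n d \<le> schlaefli n (Suc d)"
  by (induction n d rule: schlaefli.induct) auto

text \<open>A further hyperplane at most doubles the number of regions. After division by powers of
  two this becomes monotonicity of \<open>head_prob\<close>.\<close>

lemma schlaefli_Suc_le: "schlaefli (Suc n) d \<le> 2 * schlaefli n d"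
  using schlaefli_mono[of n] by (cases d) (auto simp: mult_2)

lemma head_prob_eq_schlaefli:
  assumes "m > 0" "n > 0"
  shows "head_prob m n = schlaefli n m / 2 ^ n"
proof -
  obtain n' where n: "n = Suc n'" using assms by (cases n) auto
  \<comment> \<open>Truncated subtraction makes \<open>m > 0\<close> essential here: for
    \<open>m = 0\<close> the left side would still contain 0.\<close>
  have *: "{0..m - 1} = {..<m}" using assms by auto
  have "2 powi (- int n + 1) = (1 / 2 ^ n' :: real)"
    by (simp add: n power_int_minus field_simps)
  then show ?thesis
    unfolding head_prob_def * by (simp add: n schlaefli_Suc)
qed

text \<open>This covers vectors with fewer than \<open>k\<close> free entries: more bound
  coordinates lower the probability of failure.\<close>

lemma head_prob_antimono:
  assumes "m > 0" "0 < n" "n \<le> n'"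
  shows "head_prob m n' \<le> head_prob m n"
  using assms(3)
proof (induction n' rule: dec_induct)
  case (step j)
  have "real (schlaefli (Suc j) m) \<le> 2 * schlaefli j m"
    using schlaefli_Suc_le[of j m] by linarith
  then have "head_prob m (Suc j) \<le> head_prob m j"
    using assms step by (simp add: head_prob_eq_schlaefli field_simps del: schlaefli.simps)
  then show ?case using step by simp
qed simp

text \<open>Only the set \<open>Z\<close> where \<open>y\<close> gives zero needs repair. General
  position makes \<open>Z\<close> so small that some \<open>z\<close> realizes any wanted signs
  there, and a small multiple of \<open>z\<close> added to \<open>y\<close> keeps the signs
  elsewhere.\<close>

lemma weak_sign_pattern_realizable:
  fixes c :: "'i \<Rightarrow> 'a::euclidean_space"
  assumes "finite I" "general_position I c UNIV" "P \<subseteq> I" "y \<noteq> 0"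
    and "\<forall>i\<in>P. c i \<bullet> y \<ge> 0" "\<forall>i\<in>I - P. c i \<bullet> y \<le> 0"
  shows "P \<in> sign_patterns I c UNIV"
proof -
  define Z where "Z = {i\<in>I. c i \<bullet> y = 0}"
  have Z: "Z \<subseteq> I" "finite Z" using assms(1) by (auto simp: Z_def)
  have card_Z: "card Z \<le> DIM('a)"
  proof (rule ccontr)
    assume "\<not> ?thesis"
    \<comment> \<open>As many functionals as the dimension, in general position, vanish together
      only at 0, contradicting \<open>y \<noteq> 0\<close>.\<close>
    then obtain J where J: "J \<subseteq> Z" "card J = DIM('a)"
      by (meson nle_le obtain_subset_with_card_n)
    then have "dim {y. \<forall>j\<in>J. c j \<bullet> y = 0} + card J = DIM('a)"
      using assms(2) Z(1) unfolding general_position_def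
      by (metis (no_types, lifting) Collect_cong UNIV_I dim_UNIV le_refl subset_trans)
    then have "{y. \<forall>j\<in>J. c j \<bullet> y = 0} \<subseteq> {0}" using J by simp
    then show False using assms(4) J by (auto simp: Z_def)
  qed
  \<comment> \<open>At most \<open>DIM('a)\<close> hyperplanes have \<open>2 ^ card Z\<close>
    regions, so by counting no pattern is missing.\<close>
  have "sign_patterns Z c UNIV = Pow Z"
  proof (rule card_subset_eq)
    show "card (sign_patterns Z c UNIV) = card (Pow Z)"
      using card_sign_patterns[OF Z(2) subspace_UNIV general_position_subset[OF assms(2) Z(1)]]
        schlaefli_full[OF card_Z] Z(2) by (simp add: card_Pow)
  qed (use Z(2) in \<open>simp_all add: sign_patterns_subset\<close>)
  then have "P \<inter> Z \<in> sign_patterns Z c UNIV" by auto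
  then obtain z where z: "\<forall>i\<in>P \<inter> Z. c i \<bullet> z > 0" "\<forall>i\<in>Z - P \<inter> Z. c i \<bullet> z < 0"
    by (auto simp: sign_patterns_def)
  have strict: "\<forall>i\<in>P - Z. c i \<bullet> y > 0" "\<forall>i\<in>(I - Z) - (P - Z). c i \<bullet> y < 0"
    using assms(3,5,6) by (force simp: Z_def)+
  obtain t where t: "t > 0" "\<forall>i\<in>P - Z. c i \<bullet> (y + t *\<^sub>R z) > 0"
    "\<forall>i\<in>(I - Z) - (P - Z). c i \<bullet> (y + t *\<^sub>R z) < 0"
    by (rule sign_patterns_perturb[OF _ _ strict, of z]) (use assms(1,3) in auto)
  have on_Z: "c i \<bullet> (y + t *\<^sub>R z) = t * (c i \<bullet> z)" if "i \<in> Z" for i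
    using that by (simp add: Z_def inner_add_right)
  have "c i \<bullet> (y + t *\<^sub>R z) > 0" if "i \<in> P" for i
    using that t z on_Z by (cases "i \<in> Z") auto
  moreover have "c i \<bullet> (y + t *\<^sub>R z) < 0" if "i \<in> I - P" for i
    using that t z on_Z by (cases "i \<in> Z") (auto simp: mult_pos_neg)
  ultimately show ?thesis
    using assms(3) unfolding sign_patterns_def by blast
qed

text \<open>A set of at most \<open>CARD('m)\<close> columns extends to one of exactly that size,
  hence is independent. Its common zeros form the orthogonal complement of its span, which gives the
  dimension.\<close>

lemma general_position_columns:
  fixes B :: "real ^ 'N::finite ^ 'm::finite"
  assumes "CARD('m) \<le> CARD('N)"
    and indep: "\<And>J :: 'N set. card J = CARD('m) \<Longrightarrow>
      inj_on (\<lambda>j. column j B) J \<and> independent ((\<lambda>j. column j B) ` J)"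
  shows "general_position UNIV (\<lambda>j. column j B) UNIV"
  unfolding general_position_def
proof (intro allI impI)
  fix J :: "'N set"
  assume "card J \<le> dim (UNIV :: (real ^ 'm) set)"
  then obtain K where K: "J \<subseteq> K" "card K = CARD('m)"
    using exists_subset_between[of J "CARD('m)" UNIV] assms(1) by auto
  let ?C = "(\<lambda>j. column j B) ` J"
  have "card ?C = card J"
    using indep[OF K(2)] K(1) by (meson card_image inj_on_subset)
  moreover have "independent ?C"
    using indep[OF K(2)] K(1) by (meson image_mono independent_mono)
  ultimately have "dim (span ?C) = card J"
    by (simp add: dim_eq_card_independent)
  moreover have "{y\<in>UNIV. \<forall>x\<in>span ?C. orthogonal x y} = {y\<in>UNIV. \<forall>j\<in>J. column j B \<bullet> y = 0}"
  proof (intro Collect_cong conj_cong refl iffI ballI)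
    fix y x assume "\<forall>j\<in>J. column j B \<bullet> y = 0" "x \<in> span ?C"
    then have "orthogonal y x"
      by (intro orthogonal_to_span[of x ?C]) (auto simp: orthogonal_def inner_commute)
    then show "orthogonal x y" by (simp add: orthogonal_commute)
  qed (auto simp: orthogonal_def span_base)
  ultimately show "dim {y\<in>UNIV. \<forall>j\<in>J. column j B \<bullet> y = 0} + card J = dim (UNIV :: (real ^ 'm) set)"
    using dim_subspace_orthogonal_to_vectors[of "span ?C" UNIV] by simp
qed

section \<open>Unique recovery as a condition on the nullspace\<close>

text \<open>For \<open>x\<close> in the cube this is its tangent cone there; free entries impose no
  condition.\<close>

definition feasible_cone :: "real ^ 'N::finite \<Rightarrow> (real ^ 'N) set"
  where "feasible_cone x = {v. \<forall>i. (x $ i = 0 \<longrightarrow> v $ i \<ge> 0) \<and> (x $ i = 1 \<longrightarrow> v $ i \<le> 0)}"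

lemma hypercube_step:
  fixes x v :: "real ^ 'N::finite"
  assumes "x \<in> hypercube" "v \<in> feasible_cone x"
  obtains t where "t > 0" "x + t *\<^sub>R v \<in> hypercube"
proof -
  have "eventually (\<lambda>t. x $ i + t * v $ i \<in> {0..1}) (at_right 0)" for i
  proof -
    have lim: "((\<lambda>t. x $ i + t * v $ i) \<longlongrightarrow> x $ i + 0 * v $ i) (at_right 0)"
      by (intro tendsto_intros)
    have x: "0 \<le> x $ i" "x $ i \<le> 1"
      using assms(1) by (auto simp: hypercube_def)
    have "eventually (\<lambda>t. x $ i + t * v $ i \<ge> 0) (at_right 0)"
    proof (cases "x $ i = 0")
      case True
      then have "v $ i \<ge> 0" using assms(2) by (auto simp: feasible_cone_def)
      then show ?thesis
        using True by (intro eventually_mono[OF eventually_at_right_less]) auto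
    next
      case False
      then show ?thesis
        using x by (intro eventually_mono[OF order_tendstoD(1)[OF lim, of 0]]) auto
    qed
    moreover have "eventually (\<lambda>t. x $ i + t * v $ i \<le> 1) (at_right 0)"
    proof (cases "x $ i = 1")
      case True
      then have "v $ i \<le> 0" using assms(2) by (auto simp: feasible_cone_def)
      then show ?thesis
        using True by (intro eventually_mono[OF eventually_at_right_less]) (auto simp: mult_nonneg_nonpos)
    next
      case False
      then show ?thesis
        using x by (intro eventually_mono[OF order_tendstoD(2)[OF lim, of 1]]) auto
    qed
    ultimately show ?thesis by eventually_elim auto
  qed
  then have "eventually (\<lambda>t. t > 0 \<and> (\<forall>i. x $ i + t * v $ i \<in> {0..1})) (at_right 0)"
    by (intro eventually_conj eventually_at_right_less eventually_all_finite)
  from eventually_happens[OF this] show ?thesis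
    using that by (auto simp: hypercube_def)
qed

text \<open>A second solution \<open>x\<close> gives the feasible null direction
  \<open>x - x\<^sub>0\<close>. Conversely, a short step along such a direction stays in the cube
  and keeps the image under \<open>A\<close>.\<close>

lemma unique_solution_iff:
  fixes A :: "real ^ 'N::finite ^ 'n::finite"
  assumes "x\<^sub>0 \<in> hypercube"
  shows "{x \<in> hypercube. A *v x = A *v x\<^sub>0} = {x\<^sub>0} \<longleftrightarrow>
    (\<forall>v \<in> nullspace A \<inter> feasible_cone x\<^sub>0. v = 0)"
proof
  assume L: "{x \<in> hypercube. A *v x = A *v x\<^sub>0} = {x\<^sub>0}"
  show "\<forall>v \<in> nullspace A \<inter> feasible_cone x\<^sub>0. v = 0"
  proof
    fix v assume v: "v \<in> nullspace A \<inter> feasible_cone x\<^sub>0"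
    then obtain t where t: "t > 0" "x\<^sub>0 + t *\<^sub>R v \<in> hypercube"
      using hypercube_step[OF assms] by blast
    have "A *v (x\<^sub>0 + t *\<^sub>R v) = A *v x\<^sub>0"
      using v by (simp add: nullspace_def matrix_vector_right_distrib matrix_vector_mult_scaleR)
    then have "x\<^sub>0 + t *\<^sub>R v = x\<^sub>0" using L t(2) by blast
    then show "v = 0" using t(1) by simp
  qed
next
  assume R: "\<forall>v \<in> nullspace A \<inter> feasible_cone x\<^sub>0. v = 0"
  have "x = x\<^sub>0" if "x \<in> hypercube" "A *v x = A *v x\<^sub>0" for x
  proof -
    have "x - x\<^sub>0 \<in> nullspace A \<inter> feasible_cone x\<^sub>0"
      using that by (auto simp: nullspace_def feasible_cone_def hypercube_def matrix_vector_mult_diff_distrib)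
    then have "x - x\<^sub>0 = 0" using R by blast
    then show ?thesis by simp
  qed
  then show "{x \<in> hypercube. A *v x = A *v x\<^sub>0} = {x\<^sub>0}" using assms by blast
qed

text \<open>Failure of uniqueness is witnessed by a unit vector, so the bad matrices form the projection of a closed
  set along the compact sphere.\<close>
lemma open_unique_solution:
  fixes x\<^sub>0 :: "real ^ 'N::finite"
  assumes "x\<^sub>0 \<in> hypercube"
  shows "open {A :: real ^ 'N ^ 'n::finite. {x \<in> hypercube. A *v x = A *v x\<^sub>0} = {x\<^sub>0}}"
proof -
  let ?S = "sphere (0 :: real ^ 'N) 1"
  let ?T = "{p :: (real ^ 'N) \<times> (real ^ 'N ^ 'n). fst p \<in> feasible_cone x\<^sub>0 \<and> snd p *v fst p = 0}"
  have "closed {p :: (real ^ 'N) \<times> (real ^ 'N ^ 'n). fst p \<in> feasible_cone x\<^sub>0}"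
    unfolding feasible_cone_def mem_Collect_eq
    by (intro closed_Collect_all closed_Collect_conj closed_Collect_imp open_Collect_const
        closed_Collect_le continuous_intros)
  moreover have "closed {p :: (real ^ 'N) \<times> (real ^ 'N ^ 'n). snd p *v fst p = 0}"
    unfolding matrix_vector_mult_def
    by (intro closed_Collect_eq continuous_intros continuous_on_vec_lambda)
  ultimately have "closed ?T" by (rule closed_Collect_conj)
  then have "closed {A. \<exists>v. v \<in> ?S \<and> (v, A) \<in> ?T}"
    by (rule closed_compact_projection[OF compact_sphere])
  moreover have "{A. \<exists>v. v \<in> ?S \<and> (v, A) \<in> ?T} =
      - {A :: real ^ 'N ^ 'n. {x \<in> hypercube. A *v x = A *v x\<^sub>0} = {x\<^sub>0}}"
  proof (intro equalityI subsetI)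
    fix A :: "real ^ 'N ^ 'n"
    assume "A \<in> - {A. {x \<in> hypercube. A *v x = A *v x\<^sub>0} = {x\<^sub>0}}"
    then obtain v where v: "v \<in> feasible_cone x\<^sub>0" "A *v v = 0" "v \<noteq> 0"
      using unique_solution_iff[OF assms, of A] by (auto simp: nullspace_def)
    then have "(1 / norm v) *\<^sub>R v \<in> ?S" "((1 / norm v) *\<^sub>R v, A) \<in> ?T"
      by (auto simp: feasible_cone_def matrix_vector_mult_scaleR divide_nonpos_nonneg)
    then show "A \<in> {A. \<exists>v. v \<in> ?S \<and> (v, A) \<in> ?T}" by blast
  next
    fix A :: "real ^ 'N ^ 'n"
    assume "A \<in> {A. \<exists>v. v \<in> ?S \<and> (v, A) \<in> ?T}"
    then obtain v where "norm v = 1" "v \<in> nullspace A \<inter> feasible_cone x\<^sub>0"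
      by (auto simp: nullspace_def)
    moreover from this have "v \<noteq> 0" by auto
    ultimately show "A \<in> - {A. {x \<in> hypercube. A *v x = A *v x\<^sub>0} = {x\<^sub>0}}"
      using unique_solution_iff[OF assms, of A] by blast
  qed
  ultimately show ?thesis by (simp only: open_closed)
qed

text \<open>The link to sign patterns: coordinate \<open>i\<close> of the row combination with
  coefficients \<open>y\<close> is the value of the functional given by column
  \<open>i\<close>.\<close>

lemma vector_matrix_mult_nth: "(y v* B) $ i = column i B \<bullet> (y :: real ^ 'm::finite)"
  by (simp add: vector_matrix_mult_def column_def inner_vec_def mult.commute)

lemma span_rows: "span (rows B) = range (\<lambda>y. y v* (B :: real ^ 'N::finite ^ 'm::finite))"
proof (intro equalityI subsetI)
  fix v assume "v \<in> span (rows B)"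
  moreover have "subspace (range (\<lambda>y. y v* B))"
    using linear_subspace_image[OF matrix_vector_mul_linear[of "transpose B"] subspace_UNIV]
    by simp
  moreover have "rows B \<subseteq> range (\<lambda>y. y v* B)"
  proof
    fix r assume "r \<in> rows B"
    then obtain i where "r = row i B" by (auto simp: rows_def)
    then have "r = axis i 1 v* B"
      by (simp add: vec_eq_iff vector_matrix_mult_nth inner_axis column_def row_def)
    then show "r \<in> range (\<lambda>y. y v* B)" by blast
  qed
  ultimately show "v \<in> range (\<lambda>y. y v* B)"
    using span_minimal by blast
next
  fix v assume "v \<in> range (\<lambda>y. y v* B)"
  then obtain y where "v = y v* B" by blast
  also have "\<dots> = (\<Sum>i\<in>UNIV. y $ i *\<^sub>R row i B)"
    by (simp add: vec_eq_iff vector_matrix_mult_def row_def mult.commute)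
  also have "\<dots> \<in> span (rows B)"
    by (intro span_sum span_scale span_base) (auto simp: rows_def)
  finally show "v \<in> span (rows B)" .
qed

text \<open>A feasible direction has weak sign + where \<open>x\<^sub>0\<close> is 0 and - where it
  is 1; general position makes these signs strict.\<close>

lemma unique_solution_iff_sign_patterns:
  fixes A :: "real ^ 'N::finite ^ 'n::finite" and B :: "real ^ 'N ^ 'm::finite"
  assumes "x\<^sub>0 \<in> hypercube" "nullspace A = span (rows B)"
    and "general_position UNIV (\<lambda>j. column j B) UNIV" "- free_entries x\<^sub>0 \<noteq> {}"
  shows "{x \<in> hypercube. A *v x = A *v x\<^sub>0} = {x\<^sub>0} \<longleftrightarrow>
    {i. x\<^sub>0 $ i = 0} \<notin> sign_patterns (- free_entries x\<^sub>0) (\<lambda>j. column j B) UNIV"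
proof -
  let ?I = "- free_entries x\<^sub>0" and ?P = "{i. x\<^sub>0 $ i = 0}"
  have I: "?I = {i. x\<^sub>0 $ i = 0 \<or> x\<^sub>0 $ i = 1}" by (auto simp: free_entries_def)
  have "(\<exists>v \<in> span (rows B) \<inter> feasible_cone x\<^sub>0. v \<noteq> 0) \<longleftrightarrow>
    ?P \<in> sign_patterns ?I (\<lambda>j. column j B) UNIV"
  proof
    assume "\<exists>v \<in> span (rows B) \<inter> feasible_cone x\<^sub>0. v \<noteq> 0"
    then obtain y where y: "y v* B \<in> feasible_cone x\<^sub>0" "y v* B \<noteq> 0"
      by (auto simp: span_rows)
    show "?P \<in> sign_patterns ?I (\<lambda>j. column j B) UNIV"
    proof (rule weak_sign_pattern_realizable)
      show "general_position ?I (\<lambda>j. column j B) UNIV"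
        using assms(3) general_position_subset by blast
      show "y \<noteq> 0" using y(2) by auto
    qed (use y(1) in \<open>auto simp: feasible_cone_def I vector_matrix_mult_nth\<close>)
  next
    assume "?P \<in> sign_patterns ?I (\<lambda>j. column j B) UNIV"
    then obtain y where y: "\<forall>i\<in>?P. column i B \<bullet> y > 0" "\<forall>i\<in>?I - ?P. column i B \<bullet> y < 0"
      by (auto simp: sign_patterns_def)
    \<comment> \<open>A bound coordinate has a strict sign, so the direction is nonzero. With no
      bound coordinate, \<open>y = 0\<close> would realize the empty pattern.\<close>
    obtain i where "i \<in> ?I" using assms(4) by blast
    then have "(y v* B) $ i \<noteq> 0"
      using y unfolding vector_matrix_mult_nth by (cases "i \<in> ?P") force+
    then have "y v* B \<noteq> 0" by auto
    moreover have "y v* B \<in> feasible_cone x\<^sub>0"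
      using y by (auto simp: feasible_cone_def vector_matrix_mult_nth I intro!: less_imp_le)
    ultimately show "\<exists>v \<in> span (rows B) \<inter> feasible_cone x\<^sub>0. v \<noteq> 0"
      by (auto simp: span_rows)
  qed
  then show ?thesis
    using unique_solution_iff[OF assms(1), of A] assms(2) by blast
qed

section \<open>Equidistribution of sign patterns\<close>

text \<open>For fixed \<open>y\<close> the conditions are finitely many strict inequalities in
  \<open>B\<close>; the union over all \<open>y\<close> is open although uncountable, which yields
  measurability.\<close>

lemma open_sign_patterns:
  fixes I :: "'N::finite set"
  shows "open {B :: real ^ 'N ^ 'm::finite. P \<in> sign_patterns I (\<lambda>j. column j B) UNIV}"
proof -
  have eq: "{B :: real ^ 'N ^ 'm. P \<in> sign_patterns I (\<lambda>j. column j B) UNIV} =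
    (if P \<subseteq> I then \<Union>y. (\<Inter>i\<in>P. {B. column i B \<bullet> y > 0}) \<inter> (\<Inter>i\<in>I - P. {B. column i B \<bullet> y < 0})
     else {})"
    by (auto simp: sign_patterns_def)
  show ?thesis
    unfolding eq unfolding column_def
    by (auto intro!: open_UN open_Int open_INT open_Collect_less continuous_intros
        continuous_on_vec_lambda)
qed

lemma sets_sign_patterns:
  fixes B :: "'w \<Rightarrow> real ^ 'N::finite ^ 'm::finite"
  assumes "B \<in> borel_measurable M"
  shows "{\<omega>\<in>space M. P \<in> sign_patterns I (\<lambda>j. column j (B \<omega>)) UNIV} \<in> sets M"
  using measurable_sets[OF assms borel_open[OF open_sign_patterns[of P I]]]
  by (simp add: vimage_def Int_def conj_commute)

lemma sign_flip_columns:
  fixes B :: "real ^ 'N::finite ^ 'm::finite" and s :: "'N \<Rightarrow> real"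
  shows "column j (B ** (\<chi> i j. if i = j then s i else 0)) = s j *\<^sub>R column j B"
  by (simp add: vec_eq_iff column_def matrix_matrix_mult_def if_distrib[where f="\<lambda>x. _ * x"]
      mult.commute cong: if_cong)

lemma orthant_symmetric_sign_patterns:
  fixes B :: "'w \<Rightarrow> real ^ 'N::finite ^ 'm::finite"
  assumes "orthant_symmetric M B" "P \<subseteq> I" "Q \<subseteq> I"
  shows "measure M {\<omega>\<in>space M. P \<in> sign_patterns I (\<lambda>j. column j (B \<omega>)) UNIV} =
    measure M {\<omega>\<in>space M. Q \<in> sign_patterns I (\<lambda>j. column j (B \<omega>)) UNIV}"
proof -
  \<comment> \<open>Flipping exactly the columns on which \<open>P\<close> and \<open>Q\<close>
    disagree exchanges the two patterns.\<close>
  define s :: "'N \<Rightarrow> real" where "s i = (if i \<in> P \<longleftrightarrow> i \<in> Q then 1 else -1)" for i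
  define S :: "real ^ 'N ^ 'N" where "S = (\<chi> i j. if i = j then s i else 0)"
  let ?\<Omega> = "{C :: real ^ 'N ^ 'm. P \<in> sign_patterns I (\<lambda>j. column j C) UNIV}"
  have "sign_diagonal S" by (auto simp: sign_diagonal_def S_def s_def)
  moreover have "?\<Omega> \<in> sets borel" using open_sign_patterns by (rule borel_open)
  ultimately have "measure M {\<omega>\<in>space M. B \<omega> ** S \<in> ?\<Omega>} = measure M {\<omega>\<in>space M. B \<omega> \<in> ?\<Omega>}"
    using assms(1) unfolding orthant_symmetric_def by blast
  moreover have "C ** S \<in> ?\<Omega> \<longleftrightarrow> Q \<in> sign_patterns I (\<lambda>j. column j C) UNIV" for C :: "real ^ 'N ^ 'm"
  proof -
    have "((\<forall>i\<in>P. column i (C ** S) \<bullet> y > 0) \<and> (\<forall>i\<in>I - P. column i (C ** S) \<bullet> y < 0)) \<longleftrightarrow>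
      ((\<forall>i\<in>Q. column i C \<bullet> y > 0) \<and> (\<forall>i\<in>I - Q. column i C \<bullet> y < 0))" for y
    proof -
      have "((\<forall>i\<in>R. f i > 0) \<and> (\<forall>i\<in>I - R. f i < 0)) \<longleftrightarrow>
          (\<forall>i\<in>I. if i \<in> R then f i > 0 else f i < 0)" if "R \<subseteq> I" for R and f :: "'N \<Rightarrow> real"
        using that by auto
      note this[OF assms(2)] this[OF assms(3)]
      moreover have "(if i \<in> P then column i (C ** S) \<bullet> y > 0 else column i (C ** S) \<bullet> y < 0) \<longleftrightarrow>
          (if i \<in> Q then column i C \<bullet> y > 0 else column i C \<bullet> y < 0)" for i
        unfolding S_def sign_flip_columns by (simp add: s_def)
      ultimately show ?thesis by simp
    qed
    then show ?thesis using assms(2,3) by (simp add: sign_patterns_def)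
  qed
  ultimately show ?thesis by simp
qed

text \<open>The \<open>2 ^ card I\<close> patterns are equally likely, and their probabilities add
  up to the expected number of realized patterns. That number is almost surely constant.\<close>

lemma prob_sign_pattern:
  fixes B :: "'w \<Rightarrow> real ^ 'N::finite ^ 'm::finite"
  assumes "prob_space M" "B \<in> borel_measurable M" "orthant_symmetric M B" "P \<subseteq> I"
    and gp: "AE \<omega> in M. general_position UNIV (\<lambda>j. column j (B \<omega>)) UNIV"
  shows "measure M {\<omega>\<in>space M. P \<in> sign_patterns I (\<lambda>j. column j (B \<omega>)) UNIV} =
    schlaefli (card I) CARD('m) / 2 ^ card I"
proof -
  interpret prob_space M by fact
  define E where "E Q = {\<omega>\<in>space M. Q \<in> sign_patterns I (\<lambda>j. column j (B \<omega>)) UNIV}" for Q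
  have E: "E Q \<in> sets M" for Q
    unfolding E_def using assms(2) by (rule sets_sign_patterns)
  have count: "(\<Sum>Q\<in>Pow I. indicator (E Q) \<omega>) = real (schlaefli (card I) CARD('m))"
    if "general_position UNIV (\<lambda>j. column j (B \<omega>)) UNIV" "\<omega> \<in> space M" for \<omega>
  proof -
    have "(\<Sum>Q\<in>Pow I. indicator (E Q) \<omega>) = real (card {Q\<in>Pow I. \<omega> \<in> E Q})"
      by (simp add: indicator_def sum.If_cases Int_def)
    also have "{Q\<in>Pow I. \<omega> \<in> E Q} = sign_patterns I (\<lambda>j. column j (B \<omega>)) UNIV"
      using that(2) by (auto simp: E_def sign_patterns_def)
    also have "card \<dots> = schlaefli (card I) CARD('m)"
      using card_sign_patterns[OF _ subspace_UNIV general_position_subset[OF that(1)], of I] by simp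
    finally show ?thesis .
  qed
  have "2 ^ card I * prob (E P) = (\<Sum>Q\<in>Pow I. prob (E P))"
    by (simp add: card_Pow)
  also have "\<dots> = (\<Sum>Q\<in>Pow I. prob (E Q))"
    unfolding E_def by (intro sum.cong refl orthant_symmetric_sign_patterns[OF assms(3,4)]) auto
  also have "\<dots> = (\<Sum>Q\<in>Pow I. expectation (indicator (E Q)))"
    using E by simp
  also have "\<dots> = expectation (\<lambda>\<omega>. \<Sum>Q\<in>Pow I. indicator (E Q) \<omega>)"
    using E by (subst Bochner_Integration.integral_sum) (auto simp: integrable_indicator_iff emeasure_eq_measure)
  also have "\<dots> = expectation (\<lambda>\<omega>. real (schlaefli (card I) CARD('m)))"
  proof (rule integral_cong_AE)
    show "AE \<omega> in M. (\<Sum>Q\<in>Pow I. indicator (E Q) \<omega>) = real (schlaefli (card I) CARD('m))"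
      using gp AE_space by eventually_elim (rule count)
  qed (use E in measurable)
  also have "\<dots> = real (schlaefli (card I) CARD('m))" by (simp add: prob_space)
  finally show ?thesis by (simp add: E_def field_simps)
qed

section \<open>The probability of unique recovery\<close>

theorem mainTheorem8:
  fixes M :: "'w measure"
    and A :: "'w \<Rightarrow> real ^ 'N::finite ^ 'n::finite"
    and B :: "'w \<Rightarrow> real ^ 'N ^ 'm::finite"
    and b :: "'w \<Rightarrow> real ^ 'n"
    and x\<^sub>0 :: "real ^ 'N"
    and k :: nat
  assumes "prob_space M"
    and "k < CARD('n)" and "CARD('n) < CARD('N)"
    and "k_simple k x\<^sub>0"
    and "A \<in> borel_measurable M" and "B \<in> borel_measurable M"
    and "orthant_symmetric M B" and "generic_matrix M B"
    and "nullspace_spanned_by M A B"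
    and "\<And>\<omega>. b \<omega> = A \<omega> *v x\<^sub>0"
  shows "measure M {\<omega> \<in> space M. {x \<in> hypercube. A \<omega> *v x = b \<omega>} = {x\<^sub>0}}
           \<ge> 1 - head_prob (CARD('N) - CARD('n)) (CARD('N) - k) \<and>
         (card (free_entries x\<^sub>0) = k \<longrightarrow>
           measure M {\<omega> \<in> space M. {x \<in> hypercube. A \<omega> *v x = b \<omega>} = {x\<^sub>0}}
             = 1 - head_prob (CARD('N) - CARD('n)) (CARD('N) - k))"
proof -
  interpret prob_space M by fact
  let ?U = "{\<omega> \<in> space M. {x \<in> hypercube. A \<omega> *v x = b \<omega>} = {x\<^sub>0}}"
  let ?m = "CARD('N) - CARD('n)"
  let ?I = "- free_entries x\<^sub>0" and ?P = "{i. x\<^sub>0 $ i = 0}"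
  define F where "F = {\<omega>\<in>space M. ?P \<in> sign_patterns ?I (\<lambda>j. column j (B \<omega>)) UNIV}"
  have x\<^sub>0: "x\<^sub>0 \<in> hypercube" and free: "card (free_entries x\<^sub>0) \<le> k"
    using assms(4) by (auto simp: k_simple_def)
  have m: "CARD('m) = ?m" using assms(9) by (simp add: nullspace_spanned_by_def)
  have card_I: "card ?I = CARD('N) - card (free_entries x\<^sub>0)"
    by (simp add: Compl_eq_Diff_UNIV card_Diff_subset)
  then have "?I \<noteq> {}" using free assms(2,3) by (intro notI) simp
  \<comment> \<open>There are only finitely many column sets \<open>J\<close>, so their exceptional
    null sets can be merged.\<close>
  have "AE \<omega> in M. \<forall>J :: 'N set. card J = CARD('m) \<longrightarrow> inj_on (\<lambda>j. column j (B \<omega>)) J \<and>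
      independent ((\<lambda>j. column j (B \<omega>)) ` J)"
    using assms(8) unfolding generic_matrix_def by (intro AE_all_countable[THEN iffD2] allI AE_impI) simp
  then have gp: "AE \<omega> in M. general_position UNIV (\<lambda>j. column j (B \<omega>)) UNIV"
    by eventually_elim (rule general_position_columns, use m in auto)
  have U: "?U \<in> sets M"
    using measurable_sets[OF assms(5) borel_open[OF open_unique_solution[OF x\<^sub>0]]] assms(10)
    by (simp add: vimage_def Int_def conj_commute)
  have F: "F \<in> sets M"
    unfolding F_def using assms(6) by (rule sets_sign_patterns)
  have "prob ?U = prob (space M - F)"
  proof (rule measure_eq_AE)
    have "AE \<omega> in M. nullspace (A \<omega>) = span (rows (B \<omega>))"
      using assms(9) by (simp add: nullspace_spanned_by_def)
    with gp AE_space show "AE \<omega> in M. \<omega> \<in> ?U \<longleftrightarrow> \<omega> \<in> space M - F"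
    proof eventually_elim
      case (elim \<omega>)
      from unique_solution_iff_sign_patterns[OF x\<^sub>0 elim(3,1) \<open>?I \<noteq> {}\<close>] elim(2)
      show ?case unfolding F_def assms(10) by blast
    qed
  qed (use U F in auto)
  also have "\<dots> = 1 - prob F" using F by (simp add: prob_compl)
  also have "prob F = head_prob ?m (CARD('N) - card (free_entries x\<^sub>0))"
    unfolding F_def
    using prob_sign_pattern[OF assms(1,6,7) _ gp, of ?P ?I] card_I free assms(2,3) m
    by (subst head_prob_eq_schlaefli) (auto simp: free_entries_def)
  finally have prob_U: "prob ?U = 1 - head_prob ?m (CARD('N) - card (free_entries x\<^sub>0))" .
  \<comment> \<open>The exact probability involves the actual number of free entries; monotonicity
    turns it into the bound with \<open>k\<close>.\<close>
  moreover have "head_prob ?m (CARD('N) - card (free_entries x\<^sub>0)) \<le> head_prob ?m (CARD('N) - k)"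
    using assms(2,3) free by (intro head_prob_antimono) auto
  ultimately show ?thesis by auto
qed

end
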